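(* Let $n>1$ be an integer. The central force law for a particle in Keplerian motion around the Lamé curve $x^{2n}+y^{2n}=1$ has the form $$F(r)=-C\,r^{4n-3}\,w^{2n-2},$$ where $(r,\theta)$ are the polar coordinates of the particle, $w=\sin\theta\cos\theta=\frac{1}{2}\sin(2\theta)$, and $C$ is a constant (independent of the position of the particle on the curve and of time) depending on the physical properties of the moving particle.
   Context: A particle of mass $m>0$ moves along the curve, with position at time $t$ given in polar coordinates about the origin by $(r(t),\theta(t))$. Keplerian motion around the curve means that the particle sweeps out radial sectorial area (area swept by the segment from the origin to the particle) at a constant nonzero rate; equivalently, the specific angular momentum $h=r^2\,\frac{d\theta}{dt}$ is a nonzero constant. Under such motion the particle is subject to a central force: its mass times its acceleration vector equals $F\,\hat{r}$, where $\hat{r}$ is the unit vector pointing from the origin to the particle, and $F$ is the (signed) central force, negative values meaning attraction towards the origin. The quantities $r$ and $\theta$ are not independent, being related by the equation $r^{2n}(\cos^{2n}\theta+\sin^{2n}\theta)=1$ of the curve, and $F(r)$ is expressed above using both. The physical properties of the particle on which $C$ may depend are its mass $m$ and specific angular momentum $h$ (for the given $n$). *)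

theory Defs
  imports "HOL-Analysis.Analysis"
begin

definition lame_curve :: "nat \<Rightarrow> (real \<times> real) set" where
  "lame_curve n = {(x, y). x ^ (2 * n) + y ^ (2 * n) = 1}"

definition polar_position :: "(real \<Rightarrow> real) \<Rightarrow> (real \<Rightarrow> real) \<Rightarrow> real \<Rightarrow> real \<times> real" where
  "polar_position r \<theta> t = (r t * cos (\<theta> t), r t * sin (\<theta> t))"

text \<open>
  Motion along a plane curve during an open time interval \<open>T\<close>, in polar coordinates about the
  origin. The radial sectorial area is swept out at the rate \<open>r\<^sup>2 \<theta>' / 2\<close>, so a constant nonzero
  rate means a constant nonzero specific angular momentum \<open>h = r\<^sup>2 \<theta>'\<close>.
  The angle \<open>\<theta>\<close> is a lift to the real line, not reduced modulo \<open>2 \<pi>\<close>.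
\<close>
definition keplerian_motion_around ::
    "(real \<times> real) set \<Rightarrow> real \<Rightarrow> real set \<Rightarrow> (real \<Rightarrow> real) \<Rightarrow> (real \<Rightarrow> real) \<Rightarrow> bool" where
  "keplerian_motion_around K h T r \<theta> \<longleftrightarrow>
     open T \<and> is_interval T \<and> h \<noteq> 0 \<and>
     (\<forall>t\<in>T. r t > 0 \<and> polar_position r \<theta> t \<in> K \<and>
        (\<exists>\<omega>. (\<theta> has_real_derivative \<omega>) (at t) \<and> (r t)\<^sup>2 * \<omega> = h))"

text \<open>
  Throughout \<open>T\<close> the trajectory \<open>p\<close> has an acceleration, and mass times acceleration is \<open>F t\<close> times
  the unit vector \<open>sgn (p t)\<close> from the origin towards the particle.
\<close>
definition central_force ::
    "real \<Rightarrow> real set \<Rightarrow> (real \<Rightarrow> real \<times> real) \<Rightarrow> (real \<Rightarrow> real) \<Rightarrow> bool" where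
  "central_force m T p F \<longleftrightarrow>
     (\<exists>v a. \<forall>t\<in>T. (p has_vector_derivative v t) (at t) \<and>
                   (v has_vector_derivative a t) (at t) \<and>
                   m *\<^sub>R a t = F t *\<^sub>R sgn (p t))"

end

theory Submission
  imports Defs
begin

text \<open>
  In Cartesian coordinates \<open>x = r cos \<theta>\<close>, \<open>y = r sin \<theta>\<close> the velocity solves two linear equations:
  differentiating the equation of the curve gives \<open>x^(2n-1) x' + y^(2n-1) y' = 0\<close>, and the constant areal
  rate is \<open>x y' - y x' = h\<close>. The determinant of this system is \<open>x^(2n) + y^(2n) = 1\<close>, so
  \<open>x' = - h y^(2n-1)\<close> and \<open>y' = h x^(2n-1)\<close>. Differentiating once more and substituting
  this velocity, the acceleration is \<open>- (2n-1) h\<^sup>2 (x y)^(2n-2)\<close> times the position vector. Since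
  \<open>x y = r\<^sup>2 w\<close> and the position vector is \<open>r\<close> times the unit vector towards the particle, this is the
  asserted law with \<open>C = (2n-1) m h\<^sup>2\<close>.

  The two points that need care are analytic. Only \<open>\<theta>\<close> is given as differentiable, so the
  differentiability of \<open>r\<close> comes from the equation of the curve
  (\<open>keplerian_lame_radius_differentiable\<close>). And the law is equivalent to centrality, not just a
  consequence: the computed acceleration shows that a central force exists, and uniqueness of
  derivatives on an open set of times shows that no other \<open>F\<close> is possible.
\<close>

lemma lame_polar_equation:
  fixes \<rho> :: real
  assumes "(\<rho> * cos \<phi>, \<rho> * sin \<phi>) \<in> lame_curve n"
  shows "\<rho> ^ (2 * n) * (cos \<phi> ^ (2 * n) + sin \<phi> ^ (2 * n)) = 1"
  using assms by (simp add: lame_curve_def power_mult_distrib distrib_left)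

text \<open>
  The curve is star-shaped about the origin: on each ray the radius is
  \<open>(cos^(2n) \<theta> + sin^(2n) \<theta>)^(-1/(2n))\<close>, a smooth function of the angle. Hence \<open>r\<close> inherits
  differentiability from \<open>\<theta>\<close>.
\<close>
lemma keplerian_lame_radius_differentiable:
  assumes n: "n > 0" and K: "keplerian_motion_around (lame_curve n) h T r \<theta>" and t: "t \<in> T"
  shows "\<exists>r'. (r has_real_derivative r') (at t)"
proof -
  have "open T" using K by (simp add: keplerian_motion_around_def)
  define u where "u s = cos (\<theta> s) ^ (2 * n) + sin (\<theta> s) ^ (2 * n)" for s
  have ru: "r s > 0 \<and> r s ^ (2 * n) * u s = 1" if "s \<in> T" for s
    using K that lame_polar_equation
    unfolding keplerian_motion_around_def polar_position_def u_def by blast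
  have r_eq: "r s = root (2 * n) (inverse (u s))" if "s \<in> T" for s
  proof -
    have "r s ^ (2 * n) = inverse (u s)"
      using ru[OF that] by (metis inverse_unique mult.commute)
    then show ?thesis
      using n ru[OF that] by (metis real_root_pos2 less_imp_le mult_pos_pos zero_less_numeral)
  qed
  have u_pos: "u t > 0"
    using ru[OF t] by (metis zero_less_mult_pos zero_less_one zero_less_power)
  obtain \<omega> where "(\<theta> has_real_derivative \<omega>) (at t)"
    using K t unfolding keplerian_motion_around_def by blast
  then have "\<exists>u'. (u has_real_derivative u') (at t)"
    unfolding u_def by (auto intro!: exI derivative_eq_intros)
  then obtain u' where "(u has_real_derivative u') (at t)" by blast
  then obtain q where q: "((\<lambda>s. inverse (u s)) has_real_derivative q) (at t)"
    using u_pos DERIV_inverse_fun by (metis less_irrefl)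
  have "(root (2 * n) has_real_derivative
           inverse (real (2 * n) * root (2 * n) (inverse (u t)) ^ (2 * n - Suc 0))) (at (inverse (u t)))"
    using n u_pos by (intro DERIV_real_root) auto
  from DERIV_chain2[OF this q]
  obtain r' where "((\<lambda>s. root (2 * n) (inverse (u s))) has_real_derivative r') (at t)" by blast
  then have "(r has_real_derivative r') (at t)"
    by (rule has_field_derivative_transform_within_open[OF _ \<open>open T\<close> t]) (simp add: r_eq)
  then show ?thesis ..
qed

text \<open>
  The tangency condition and the areal condition form a linear system for the velocity, which is
  solved by Cramer's rule; its determinant is the left-hand side of the equation of the curve.
\<close>
lemma keplerian_lame_velocity:
  fixes r \<theta> :: "real \<Rightarrow> real"
  defines "x \<equiv> \<lambda>t. r t * cos (\<theta> t)" and "y \<equiv> \<lambda>t. r t * sin (\<theta> t)"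
  assumes n: "n > 0" and K: "keplerian_motion_around (lame_curve n) h T r \<theta>" and t: "t \<in> T"
  shows "(x has_real_derivative - h * y t ^ (2 * n - 1)) (at t)"
    and "(y has_real_derivative h * x t ^ (2 * n - 1)) (at t)"
proof -
  have T: "open T" using K by (simp add: keplerian_motion_around_def)
  obtain r' where r': "(r has_real_derivative r') (at t)"
    using keplerian_lame_radius_differentiable[OF n K t] by blast
  obtain \<omega> where \<omega>: "(\<theta> has_real_derivative \<omega>) (at t)" "(r t)\<^sup>2 * \<omega> = h"
    using K t unfolding keplerian_motion_around_def by blast
  define x' where "x' = r' * cos (\<theta> t) - r t * sin (\<theta> t) * \<omega>"
  define y' where "y' = r' * sin (\<theta> t) + r t * cos (\<theta> t) * \<omega>"
  have dx: "(x has_real_derivative x') (at t)"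
    unfolding x_def x'_def by (rule derivative_eq_intros r' \<omega> refl)+ (simp add: algebra_simps)
  have dy: "(y has_real_derivative y') (at t)"
    unfolding y_def y'_def by (rule derivative_eq_intros r' \<omega> refl)+ (simp add: algebra_simps)
  have curve: "x s ^ (2 * n) + y s ^ (2 * n) = 1" if "s \<in> T" for s
    using K that
    by (auto simp: keplerian_motion_around_def polar_position_def lame_curve_def x_def y_def)
  have area: "x t * y' - y t * x' = h"
  proof -
    have "x t * y' - y t * x' = (r t)\<^sup>2 * \<omega> * ((cos (\<theta> t))\<^sup>2 + (sin (\<theta> t))\<^sup>2)"
      unfolding x_def y_def x'_def y'_def by algebra
    then show ?thesis using \<omega>(2) by simp
  qed
  define X where "X = x t ^ (2 * n - 1)"
  define Y where "Y = y t ^ (2 * n - 1)"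
  have "((\<lambda>s. x s ^ (2 * n) + y s ^ (2 * n)) has_real_derivative
          real (2 * n) * (X * x' + Y * y')) (at t)"
    by (rule derivative_eq_intros dx dy refl)+ (simp add: X_def Y_def algebra_simps)
  moreover have "((\<lambda>s. x s ^ (2 * n) + y s ^ (2 * n)) has_real_derivative 0) (at t)"
    by (rule has_field_derivative_transform_within_open[OF DERIV_const T t]) (simp add: curve)
  ultimately have tangent: "X * x' + Y * y' = 0"
    using n DERIV_unique by fastforce
  have det: "x t * X + y t * Y = 1"
    using curve[OF t] n power_minus_mult[of "2 * n" "x t"] power_minus_mult[of "2 * n" "y t"]
    by (simp add: X_def Y_def mult.commute)
  have "x' = - h * Y"
  proof -
    have "x' = (x t * X + y t * Y) * x'" using det by simp
    also have "\<dots> = x t * (X * x' + Y * y') - (x t * y' - y t * x') * Y"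
      by (simp add: algebra_simps)
    finally show ?thesis using tangent area by simp
  qed
  then show "(x has_real_derivative - h * y t ^ (2 * n - 1)) (at t)"
    using dx by (simp add: Y_def)
  have "y' = h * X"
  proof -
    have "y' = (x t * X + y t * Y) * y'" using det by simp
    also have "\<dots> = y t * (X * x' + Y * y') + (x t * y' - y t * x') * X"
      by (simp add: algebra_simps)
    finally show ?thesis using tangent area by simp
  qed
  then show "(y has_real_derivative h * x t ^ (2 * n - 1)) (at t)"
    using dy by (simp add: X_def)
qed

text \<open>
  On an open set of times derivatives are unique, so a known velocity and acceleration decide
  centrality: the quantifiers over \<open>v\<close> and \<open>a\<close> disappear.
\<close>
lemma central_force_iff_acceleration:
  fixes p :: "real \<Rightarrow> real \<times> real"
  assumes "open T"
    and v: "\<And>t. t \<in> T \<Longrightarrow> (p has_vector_derivative v t) (at t)"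
    and a: "\<And>t. t \<in> T \<Longrightarrow> (v has_vector_derivative a t) (at t)"
  shows "central_force m T p F \<longleftrightarrow> (\<forall>t\<in>T. m *\<^sub>R a t = F t *\<^sub>R sgn (p t))"
proof
  assume "central_force m T p F"
  then obtain v' a' where *: "\<And>t. t \<in> T \<Longrightarrow> (p has_vector_derivative v' t) (at t)"
      "\<And>t. t \<in> T \<Longrightarrow> (v' has_vector_derivative a' t) (at t)"
      "\<And>t. t \<in> T \<Longrightarrow> m *\<^sub>R a' t = F t *\<^sub>R sgn (p t)"
    unfolding central_force_def by blast
  have v_eq: "v' t = v t" if "t \<in> T" for t
    using *(1) v that vector_derivative_unique_at by blast
  have "a' t = a t" if "t \<in> T" for t
  proof -
    have "(v has_vector_derivative a' t) (at t)"
      by (rule has_vector_derivative_transform_within_open[OF *(2)[OF that] \<open>open T\<close> that])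
        (simp add: v_eq)
    then show ?thesis using a[OF that] vector_derivative_unique_at by blast
  qed
  then show "\<forall>t\<in>T. m *\<^sub>R a t = F t *\<^sub>R sgn (p t)" using *(3) by simp
next
  assume "\<forall>t\<in>T. m *\<^sub>R a t = F t *\<^sub>R sgn (p t)"
  then show "central_force m T p F"
    unfolding central_force_def using v a by blast
qed

lemma norm_polar_position:
  assumes "r t \<ge> 0"
  shows "norm (polar_position r \<theta> t) = r t"
proof -
  have "(norm (polar_position r \<theta> t))\<^sup>2 = (r t)\<^sup>2 * ((cos (\<theta> t))\<^sup>2 + (sin (\<theta> t))\<^sup>2)"
    by (simp only: polar_position_def norm_Pair real_norm_def power2_abs real_sqrt_pow2_iff)
      (simp only: power_mult_distrib distrib_left, simp)
  then show ?thesis using assms by simp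
qed

text \<open>
  Differentiating the velocity \<open>(- h y^(2n-1), h x^(2n-1))\<close> and substituting it into the result makes both
  components acquire the same factor, which is why the acceleration is radial.
\<close>
lemma central_force_keplerian_lame_iff:
  fixes r \<theta> F :: "real \<Rightarrow> real"
  assumes n: "n > 0" and K: "keplerian_motion_around (lame_curve n) h T r \<theta>"
  shows "central_force m T (polar_position r \<theta>) F \<longleftrightarrow>
           (\<forall>t\<in>T. F t = - (m * h\<^sup>2 * real (2 * n - 1)) * r t ^ (4 * n - 3)
                          * (sin (\<theta> t) * cos (\<theta> t)) ^ (2 * n - 2))"
proof -
  have T: "open T" using K by (simp add: keplerian_motion_around_def)
  have r_pos: "r t > 0" if "t \<in> T" for t
    using K that by (simp add: keplerian_motion_around_def)
  define x where "x = (\<lambda>t. r t * cos (\<theta> t))"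
  define y where "y = (\<lambda>t. r t * sin (\<theta> t))"
  have p: "polar_position r \<theta> = (\<lambda>t. (x t, y t))"
    by (simp add: fun_eq_iff polar_position_def x_def y_def)
  define c where "c = h\<^sup>2 * real (2 * n - 1)"
  define a where "a t = - (c * (x t * y t) ^ (2 * n - 2)) *\<^sub>R (x t, y t)" for t
  have dx: "(x has_real_derivative - h * y t ^ (2 * n - 1)) (at t)"
    and dy: "(y has_real_derivative h * x t ^ (2 * n - 1)) (at t)" if "t \<in> T" for t
    using keplerian_lame_velocity[OF n K that] by (simp_all add: x_def y_def)
  have v: "(polar_position r \<theta> has_vector_derivative
             (- h * y t ^ (2 * n - 1), h * x t ^ (2 * n - 1))) (at t)" if "t \<in> T" for t
    unfolding p using dx[OF that] dy[OF that]
    by (intro has_vector_derivative_Pair) (simp_all add: has_real_derivative_iff_has_vector_derivative)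
  have pow: "z ^ (2 * n - 1) = z ^ (2 * n - 2) * z" for z :: real
    using n power_Suc2[of z "2 * n - 2"] by (simp add: Suc_diff_Suc numeral_2_eq_2)
  have exp_pred: "2 * n - 1 - 1 = 2 * n - 2" by simp
  have a: "((\<lambda>t. (- h * y t ^ (2 * n - 1), h * x t ^ (2 * n - 1))) has_vector_derivative a t) (at t)"
    if "t \<in> T" for t
  proof -
    have "((\<lambda>t. - h * y t ^ (2 * n - 1)) has_real_derivative
            - h * (real (2 * n - 1) * (h * x t ^ (2 * n - 1) * y t ^ (2 * n - 1 - 1)))) (at t)"
      using DERIV_cmult[OF DERIV_power[OF dy[OF that], of "2 * n - 1"], of "- h"]
      by (simp add: mult_ac)
    also have "- h * (real (2 * n - 1) * (h * x t ^ (2 * n - 1) * y t ^ (2 * n - 1 - 1))) = fst (a t)"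
      unfolding a_def c_def exp_pred pow by (simp add: power_mult_distrib power2_eq_square)
    finally have ax: "((\<lambda>t. - h * y t ^ (2 * n - 1)) has_real_derivative fst (a t)) (at t)" .
    have "((\<lambda>t. h * x t ^ (2 * n - 1)) has_real_derivative
            h * (real (2 * n - 1) * (- h * y t ^ (2 * n - 1) * x t ^ (2 * n - 1 - 1)))) (at t)"
      using DERIV_cmult[OF DERIV_power[OF dx[OF that], of "2 * n - 1"], of h]
      by (simp add: mult_ac)
    also have "h * (real (2 * n - 1) * (- h * y t ^ (2 * n - 1) * x t ^ (2 * n - 1 - 1))) = snd (a t)"
      unfolding a_def c_def exp_pred pow by (simp add: power_mult_distrib power2_eq_square)
    finally have ay: "((\<lambda>t. h * x t ^ (2 * n - 1)) has_real_derivative snd (a t)) (at t)" .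
    show ?thesis
      using has_vector_derivative_Pair[OF ax[unfolded has_real_derivative_iff_has_vector_derivative]
          ay[unfolded has_real_derivative_iff_has_vector_derivative]] by simp
  qed
  have law: "m *\<^sub>R a t = F t *\<^sub>R sgn (polar_position r \<theta> t) \<longleftrightarrow>
      F t = - (m * h\<^sup>2 * real (2 * n - 1)) * r t ^ (4 * n - 3)
              * (sin (\<theta> t) * cos (\<theta> t)) ^ (2 * n - 2)" if "t \<in> T" for t
  proof -
    let ?p = "polar_position r \<theta> t"
    let ?G = "- (m * h\<^sup>2 * real (2 * n - 1)) * r t ^ (4 * n - 3)
                * (sin (\<theta> t) * cos (\<theta> t)) ^ (2 * n - 2)"
    have norm_p: "norm ?p = r t"
      using r_pos[OF that] by (intro norm_polar_position) simp
    have p_sgn: "?p = r t *\<^sub>R sgn ?p"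
      using r_pos[OF that] by (simp add: sgn_div_norm norm_p)
    have "4 * n - 3 = Suc (2 * (2 * n - 2))" using n by simp
    then have "r t ^ (4 * n - 3) = ((r t)\<^sup>2) ^ (2 * n - 2) * r t"
      by (simp only: power_Suc2 power_mult)
    moreover have "x t * y t = (r t)\<^sup>2 * (sin (\<theta> t) * cos (\<theta> t))"
      by (simp add: x_def y_def power2_eq_square)
    ultimately have G: "m * - (c * (x t * y t) ^ (2 * n - 2)) * r t = ?G"
      by (simp add: c_def power_mult_distrib mult_ac)
    have "m *\<^sub>R a t = (m * - (c * (x t * y t) ^ (2 * n - 2))) *\<^sub>R ?p"
      by (simp add: a_def p)
    also have "\<dots> = ?G *\<^sub>R sgn ?p"
      by (subst p_sgn, simp only: scaleR_scaleR G)
    finally have "m *\<^sub>R a t = ?G *\<^sub>R sgn ?p" .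
    moreover have "sgn ?p \<noteq> 0"
      using norm_p r_pos[OF that] by (auto simp: sgn_zero_iff)
    ultimately show ?thesis by (metis scaleR_cancel_right)
  qed
  show ?thesis
    using central_force_iff_acceleration[OF T v a] law by simp
qed

theorem theorem9:
  fixes n :: nat and m h :: real
  assumes "n > 1" and "m > 0" and "h \<noteq> 0"
  shows "\<exists>C::real. \<forall>T r \<theta> F. keplerian_motion_around (lame_curve n) h T r \<theta> \<longrightarrow>
           (central_force m T (polar_position r \<theta>) F \<longleftrightarrow>
             (\<forall>t\<in>T. F t = - C * r t ^ (4 * n - 3) * (sin (\<theta> t) * cos (\<theta> t)) ^ (2 * n - 2)))"
proof (intro exI allI impI)
  fix T r \<theta> F
  assume "keplerian_motion_around (lame_curve n) h T r \<theta>"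
  then show "central_force m T (polar_position r \<theta>) F \<longleftrightarrow>
      (\<forall>t\<in>T. F t = - (m * h\<^sup>2 * real (2 * n - 1)) * r t ^ (4 * n - 3)
                     * (sin (\<theta> t) * cos (\<theta> t)) ^ (2 * n - 2))"
    using assms(1) by (intro central_force_keplerian_lame_iff) auto
qed

end
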